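(* Let $k\ge 1$, $m\ge 1$, $r:=\min(m,k)$, let $B_{0,k}\in\mathbb{R}^{n\times n}$, and let $s_i,y_i\in\mathbb{R}^n$ with $s_i\neq 0$ for $i=k-r,\ldots,k-1$. Let $B_k$ be the limited memory PSB matrix obtained from the initial matrix $B_{0,k}$ by successively applying the PSB update (see context) with the pairs $(s_{k-r},y_{k-r}),\ldots,(s_{k-1},y_{k-1})$, in this order. Let $$S_k:=[s_{k-r}\ \cdots\ s_{k-1}]\in\mathbb{R}^{n\times r},\qquad Y_k:=[y_{k-r}\ \cdots\ y_{k-1}]\in\mathbb{R}^{n\times r},\qquad W_k:=Y_k-B_{0,k}S_k,$$ let $U_k$ be the (non-strictly) upper triangular part of $S_k^{\mathsf T}S_k$, $L_k$ the strictly lower triangular part of $S_k^{\mathsf T}W_k$, and $D_k$ the diagonal part of $S_k^{\mathsf T}W_k$. Then $B_k$ admits the compact representation $$B_k=B_{0,k}+\begin{bmatrix}S_k & W_k\end{bmatrix}\begin{bmatrix}0 & U_k\\ U_k^{\mathsf T} & L_k+D_k+L_k^{\mathsf T}\end{bmatrix}^{-1}\begin{bmatrix}S_k & W_k\end{bmatrix}^{\mathsf T}.$$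
   Context: PSB (Powell-symmetric-Broyden) update: given a matrix $B\in\mathbb{R}^{n\times n}$ and a pair $(s,y)\in\mathbb{R}^n\times\mathbb{R}^n$ with $s\ne0$, the updated matrix is $$B^{+}=B+\frac{(y-Bs)s^{\mathsf T}+s(y-Bs)^{\mathsf T}}{s^{\mathsf T}s}-\frac{(y-Bs)^{\mathsf T}s}{(s^{\mathsf T}s)^2}\,ss^{\mathsf T}.$$ In the limited memory setting with memory size $m$, only the last $r=\min(m,k)$ pairs $(s_i,y_i)$ are used at iteration $k$: one starts from $B_{0,k}$ and applies the update with $(s_{k-r},y_{k-r})$, then with $(s_{k-r+1},y_{k-r+1})$, and so on up to $(s_{k-1},y_{k-1})$; the result is $B_k$. In the optimization method the pairs are $s_i=x_{i+1}-x_i$ and $y_i=\nabla f(x_{i+1})-\nabla f(x_i)$, but the PSB formula makes sense for arbitrary vectors with $s_i\neq0$. *)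

theory Defs
  imports Complex_Main "Jordan_Normal_Form.Gauss_Jordan_Elimination"
begin

text \<open>The rank-one matrix \<open>u v\<^sup>T\<close>.\<close>

definition outer_prod :: "'a :: semiring_0 vec \<Rightarrow> 'a vec \<Rightarrow> 'a mat" where
  "outer_prod u v = mat (dim_vec u) (dim_vec v) (\<lambda>(i, j). u $ i * v $ j)"

definition psb_update :: "real mat \<Rightarrow> real vec \<Rightarrow> real vec \<Rightarrow> real mat" where
  "psb_update B s y =
     B + (1 / (s \<bullet> s)) \<cdot>\<^sub>m (outer_prod (y - B *\<^sub>v s) s + outer_prod s (y - B *\<^sub>v s))
       - (((y - B *\<^sub>v s) \<bullet> s) / (s \<bullet> s)\<^sup>2) \<cdot>\<^sub>m outer_prod s s"

text \<open>The list runs from the oldest used pair \<open>k - min m k\<close> to the newest \<open>k - 1\<close>;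
  \<open>fold\<close> applies the updates in this order.\<close>

definition lm_psb :: "nat \<Rightarrow> nat \<Rightarrow> (nat \<Rightarrow> real vec) \<Rightarrow> (nat \<Rightarrow> real vec) \<Rightarrow> real mat \<Rightarrow> real mat" where
  "lm_psb m k s y B0 = fold (\<lambda>i B. psb_update B (s i) (y i)) [k - min m k..<k] B0"

definition upper_part :: "'a :: zero mat \<Rightarrow> 'a mat" where
  "upper_part A = mat (dim_row A) (dim_col A) (\<lambda>(i, j). if i \<le> j then A $$ (i, j) else 0)"

definition strict_lower_part :: "'a :: zero mat \<Rightarrow> 'a mat" where
  "strict_lower_part A = mat (dim_row A) (dim_col A) (\<lambda>(i, j). if j < i then A $$ (i, j) else 0)"

definition diag_part :: "'a :: zero mat \<Rightarrow> 'a mat" where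
  "diag_part A = mat (dim_row A) (dim_col A) (\<lambda>(i, j). if i = j then A $$ (i, j) else 0)"

text \<open>The block row \<open>[A B]\<close>, the column analogue of \<open>append_rows\<close>.\<close>

definition append_cols :: "'a :: zero mat \<Rightarrow> 'a mat \<Rightarrow> 'a mat" where
  "append_cols A B = four_block_mat A B (0\<^sub>m 0 (dim_col A)) (0\<^sub>m 0 (dim_col B))"

end

theory Submission
  imports Defs "Jordan_Normal_Form.Determinant"
begin

text \<open>
  With \<open>w\<^sub>i = y\<^sub>i - B\<^sub>0 s\<^sub>i\<close>, a PSB step maps the correction \<open>E = B - B\<^sub>0\<close>, which is symmetric even
  if \<open>B\<^sub>0\<close> is not, to
  \<open>P E P + (w s\<^sup>T + s w\<^sup>T) / s\<^sup>Ts - (s\<^sup>Tw) s s\<^sup>T / (s\<^sup>Ts)\<^sup>2\<close>, where \<open>P = I - s s\<^sup>T / s\<^sup>Ts\<close>.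
  By induction on the number of pairs, \<open>E = W Q\<^sup>T + Q W\<^sup>T - Q T Q\<^sup>T\<close> with \<open>Q U\<^sup>T = S\<close> and
  \<open>T = L + D + L\<^sup>T\<close>, whose \<open>(i, j)\<close> entry is the product of \<open>s\<close> at the larger and \<open>w\<close> at the smaller
  of the two indices. Since \<open>U\<close> is triangular with diagonal entries \<open>s\<^sub>i\<^sup>Ts\<^sub>i \<noteq> 0\<close>, it has an inverse \<open>V\<close>,
  and the inverse of the middle matrix has the blocks \<open>-V\<^sup>TTV\<close>, \<open>V\<^sup>T\<close>, \<open>V\<close>, \<open>0\<close>.
  Substituting it gives the same expression in \<open>Q = S V\<^sup>T\<close>.
\<close>

section \<open>The PSB recursion, entry by entry\<close>

lemma psb_update_carrier:
  assumes "B \<in> carrier_mat n n" "s \<in> carrier_vec n" "y \<in> carrier_vec n"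
  shows "psb_update B s y \<in> carrier_mat n n"
  using assms by (auto simp: psb_update_def outer_prod_def)

text \<open>Every entry of \<open>s\<close> carries its own division by
  \<open>s \<bullet> s\<close>. The correction thus becomes a polynomial in \<open>v\<close> and the
  scaled vector that the induction below calls \<open>x\<close>.\<close>

lemma psb_update_index:
  assumes B: "B \<in> carrier_mat n n" and s: "s \<in> carrier_vec n" and y: "y \<in> carrier_vec n"
    and ab: "a < n" "b < n"
  defines "v \<equiv> y - B *\<^sub>v s"
  shows "psb_update B s y $$ (a, b) =
    B $$ (a, b) + (v $ a * (s $ b / (s \<bullet> s)) + s $ a / (s \<bullet> s) * v $ b)
      - (v \<bullet> s) * (s $ a / (s \<bullet> s)) * (s $ b / (s \<bullet> s))"
  using assms by (simp add: psb_update_def outer_prod_def power2_eq_square algebra_simps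
      add_divide_distrib diff_divide_distrib)

text \<open>The coefficient depends only on the unordered pair of indices, so the bilinear form is
  symmetric even when \<open>t\<close> is not. This lets one vector \<open>H\<close> serve both the
  row and the column side of the update.\<close>

lemma sum_min_max_symmetric:
  fixes t :: "nat \<Rightarrow> nat \<Rightarrow> 'a :: comm_semiring_1"
  shows "(\<Sum>i<c. \<Sum>j<c. t (max i j) (min i j) * f i * g j) =
    (\<Sum>i<c. \<Sum>j<c. t (max i j) (min i j) * g i * f j)"
  by (subst sum.swap) (simp add: max.commute min.commute mult_ac)

lemma fold_psb_update_carrier:
  assumes "B0 \<in> carrier_mat n n"
    and "\<And>i. i < c \<Longrightarrow> s i \<in> carrier_vec n" and "\<And>i. i < c \<Longrightarrow> y i \<in> carrier_vec n"
  shows "fold (\<lambda>i B. psb_update B (s i) (y i)) [0..<c] B0 \<in> carrier_mat n n"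
  using assms by (induction c) (auto intro!: psb_update_carrier)

text \<open>Here \<open>q i a\<close> is the entry of \<open>Q\<close> in row \<open>a\<close> and
  column \<open>i\<close>. The first conjunct is \<open>Q U\<^sup>T = S\<close>, with the sum
  starting at \<open>j\<close> because \<open>U\<close> is upper triangular; the second is the
  formula for \<open>E\<close>. With functions in place of matrices, a new pair only lengthens the
  sums.\<close>

lemma fold_psb_update_entries:
  fixes s y :: "nat \<Rightarrow> real vec"
  assumes B0: "B0 \<in> carrier_mat n n"
    and "\<And>i. i < c \<Longrightarrow> s i \<in> carrier_vec n" and "\<And>i. i < c \<Longrightarrow> y i \<in> carrier_vec n"
    and "\<And>i. i < c \<Longrightarrow> s i \<noteq> 0\<^sub>v n"
  defines "w \<equiv> \<lambda>i. y i - B0 *\<^sub>v s i"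
  shows "\<exists>q :: nat \<Rightarrow> nat \<Rightarrow> real.
    (\<forall>j<c. \<forall>a<n. (\<Sum>i=j..<c. q i a * (s j \<bullet> s i)) = s j $ a) \<and>
    (\<forall>a<n. \<forall>b<n. fold (\<lambda>i B. psb_update B (s i) (y i)) [0..<c] B0 $$ (a, b) =
      B0 $$ (a, b) + (\<Sum>i<c. w i $ a * q i b) + (\<Sum>i<c. w i $ b * q i a)
        - (\<Sum>i<c. \<Sum>j<c. (s (max i j) \<bullet> w (min i j)) * q i a * q j b))"
  using assms(2-4)
proof (induction c)
  case 0
  show ?case by simp
next
  case (Suc c)
  define E where "E = fold (\<lambda>i B. psb_update B (s i) (y i)) [0..<c] B0"
  define t where "t i j = s i \<bullet> w j" for i j
  let ?T = "\<lambda>f g. \<Sum>i<c. \<Sum>j<c. t (max i j) (min i j) * f i * g j"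
  have prev: "s i \<in> carrier_vec n" "y i \<in> carrier_vec n" "s i \<noteq> 0\<^sub>v n" if "i < c" for i
    using Suc.prems that by simp_all
  from Suc.IH[OF prev] obtain q where
    q: "\<And>j a. j < c \<Longrightarrow> a < n \<Longrightarrow> (\<Sum>i=j..<c. q i a * (s j \<bullet> s i)) = s j $ a" and
    E: "\<And>a b. a < n \<Longrightarrow> b < n \<Longrightarrow> E $$ (a, b) = B0 $$ (a, b)
      + (\<Sum>i<c. w i $ a * q i b) + (\<Sum>i<c. w i $ b * q i a) - ?T (\<lambda>i. q i a) (\<lambda>j. q j b)"
    unfolding E_def t_def by blast
  have sc: "s i \<in> carrier_vec n" if "i \<le> c" for i using Suc.prems(1) that by simp
  have yc: "y i \<in> carrier_vec n" if "i \<le> c" for i using Suc.prems(2) that by simp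
  have wc: "w i \<in> carrier_vec n" if "i \<le> c" for i
    unfolding w_def using sc[OF that] yc[OF that] B0 by simp
  have Ec: "E \<in> carrier_mat n n"
    unfolding E_def using B0 sc yc by (intro fold_psb_update_carrier) auto
  have dot: "u \<bullet> v = (\<Sum>a<n. u $ a * v $ a)" if "v \<in> carrier_vec n" for u v :: "real vec"
    using that by (simp add: scalar_prod_def lessThan_atLeast0)
  define \<rho> where "\<rho> = s c \<bullet> s c"
  have \<rho>: "\<rho> \<noteq> 0"
    using Suc.prems(3)[of c] sc[of c] conjugate_square_eq_0_vec[of "s c" n] by (simp add: \<rho>_def)
  define x where "x a = s c $ a / \<rho>" for a
  \<comment> \<open>For the old pairs, in matrix terms: \<sigma> is \<open>Q\<^sup>T s\<close>,
    \<open>F\<close> is \<open>W \<sigma>\<close>, \<open>G\<close> is \<open>Q W\<^sup>T s\<close>,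
    \<open>H\<close> is \<open>Q T \<sigma>\<close>, \<open>K\<close> is
    \<open>\<sigma>\<^sup>T T \<sigma>\<close> and \<open>N\<close> is
    \<open>s\<^sup>T W \<sigma>\<close>, where \<open>s\<close> stands for \<open>s c\<close>. So
    \<open>F + G - H\<close> is the old correction applied to \<open>s c\<close>.\<close>
  define \<sigma> where "\<sigma> i = (\<Sum>a<n. q i a * s c $ a)" for i
  define F where "F a = (\<Sum>i<c. w i $ a * \<sigma> i)" for a
  define G where "G a = (\<Sum>i<c. t c i * q i a)" for a
  define H where "H a = ?T (\<lambda>i. q i a) \<sigma>" for a
  define K where "K = ?T \<sigma> \<sigma>"
  define N where "N = (\<Sum>i<c. t c i * \<sigma> i)"
  define v where "v = y c - E *\<^sub>v s c"
  have H_sym: "?T \<sigma> (\<lambda>j. q j a) = H a" for a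
    unfolding H_def by (rule sum_min_max_symmetric)
  have t_dot: "(\<Sum>a<n. w i $ a * s c $ a) = t c i" if "i \<le> c" for i
    unfolding t_def using that by (simp add: dot wc mult.commute)
  have v: "v $ a = w c $ a - F a - G a + H a" if a: "a < n" for a
  proof -
    have "(E *\<^sub>v s c) $ a = (\<Sum>b<n. E $$ (a, b) * s c $ b)"
      using a Ec sc[of c] by (simp add: scalar_prod_def lessThan_atLeast0)
    also have "\<dots> = (\<Sum>b<n. B0 $$ (a, b) * s c $ b) + (\<Sum>b<n. (\<Sum>i<c. w i $ a * q i b) * s c $ b)
        + (\<Sum>b<n. (\<Sum>i<c. w i $ b * q i a) * s c $ b)
        - (\<Sum>b<n. ?T (\<lambda>i. q i a) (\<lambda>j. q j b) * s c $ b)"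
      using a by (simp add: E algebra_simps sum.distrib sum_subtractf)
    also have "(\<Sum>b<n. B0 $$ (a, b) * s c $ b) = (B0 *\<^sub>v s c) $ a"
      using a B0 sc[of c] by (simp add: scalar_prod_def lessThan_atLeast0)
    also have "(\<Sum>b<n. (\<Sum>i<c. w i $ a * q i b) * s c $ b) = F a"
      unfolding F_def \<sigma>_def sum_distrib_left sum_distrib_right
      by (subst sum.swap) (simp add: mult_ac)
    also have "(\<Sum>b<n. (\<Sum>i<c. w i $ b * q i a) * s c $ b) = (\<Sum>i<c. (\<Sum>b<n. w i $ b * s c $ b) * q i a)"
      unfolding sum_distrib_left sum_distrib_right by (subst sum.swap) (simp add: mult_ac)
    also have "\<dots> = G a" unfolding G_def by (simp add: t_dot)
    also have "(\<Sum>b<n. ?T (\<lambda>i. q i a) (\<lambda>j. q j b) * s c $ b) = H a"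
      unfolding H_def \<sigma>_def sum_distrib_left sum_distrib_right
      by (subst sum.swap, rule sum.cong[OF refl], subst sum.swap) (simp add: mult_ac)
    finally show ?thesis
      using a B0 Ec sc[of c] yc[of c] by (simp add: v_def w_def)
  qed
  have vs: "v \<bullet> s c = t c c - 2 * N + K"
  proof -
    have "v \<bullet> s c = (\<Sum>a<n. v $ a * s c $ a)" using sc by (simp add: dot)
    also have "\<dots> = (\<Sum>a<n. w c $ a * s c $ a) - (\<Sum>a<n. F a * s c $ a)
        - (\<Sum>a<n. G a * s c $ a) + (\<Sum>a<n. H a * s c $ a)"
      by (simp add: v algebra_simps sum.distrib sum_subtractf)
    also have "(\<Sum>a<n. F a * s c $ a) = (\<Sum>i<c. (\<Sum>a<n. w i $ a * s c $ a) * \<sigma> i)"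
      unfolding F_def sum_distrib_right by (subst sum.swap) (simp add: mult_ac)
    also have "\<dots> = N" unfolding N_def by (simp add: t_dot)
    also have "(\<Sum>a<n. G a * s c $ a) = N"
      unfolding G_def N_def \<sigma>_def sum_distrib_left sum_distrib_right
      by (subst sum.swap) (simp add: mult_ac)
    also have "(\<Sum>a<n. H a * s c $ a) = (\<Sum>i<c. \<Sum>j<c. t (max i j) (min i j) * (\<Sum>a<n. q i a * s c $ a) * \<sigma> j)"
      unfolding H_def sum_distrib_left sum_distrib_right
      by (subst sum.swap, rule sum.cong[OF refl], subst sum.swap) (simp add: mult_ac)
    also have "\<dots> = K" unfolding K_def \<sigma>_def ..
    finally show ?thesis by (simp add: t_dot)
  qed
  \<comment> \<open>The columns \<open>q i\<close> are those of \<open>S U\<^sup>-\<^sup>T\<close>: a new pair projects the old ones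
    orthogonally to \<open>s c\<close> and appends \<open>s c / (s c \<bullet> s c)\<close>.\<close>
  define q' where "q' i a = (if i < c then q i a - \<sigma> i * x a else x a)" for i a
  have q'_eq: "(\<Sum>i=j..<Suc c. q' i a * (s j \<bullet> s i)) = s j $ a" if ja: "j < Suc c" "a < n" for j a
  proof (cases "j = c")
    case True
    then show ?thesis using \<rho> by (simp add: q'_def x_def \<rho>_def)
  next
    case False
    with ja have j: "j < c" by simp
    \<comment> \<open>Pairing the induction hypothesis for \<open>s j\<close> with
      \<open>s c\<close> evaluates this sum. Projecting the old columns therefore costs
      \<open>x a * (s j \<bullet> s c)\<close>, which is exactly what the new summand at index
      \<open>c\<close> gives back.\<close>
    have "(\<Sum>i=j..<c. \<sigma> i * (s j \<bullet> s i)) = (\<Sum>b<n. (\<Sum>i=j..<c. q i b * (s j \<bullet> s i)) * s c $ b)"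
      unfolding \<sigma>_def sum_distrib_right by (subst sum.swap) (simp add: mult_ac)
    also have "\<dots> = s j \<bullet> s c" using j by (simp add: q dot[OF sc[of c]])
    finally have \<sigma>: "(\<Sum>i=j..<c. \<sigma> i * (s j \<bullet> s i)) = s j \<bullet> s c" .
    have "(\<Sum>i=j..<c. q' i a * (s j \<bullet> s i)) = (\<Sum>i=j..<c. q i a * (s j \<bullet> s i) - x a * (\<sigma> i * (s j \<bullet> s i)))"
      by (rule sum.cong) (auto simp: q'_def algebra_simps)
    also have "\<dots> = s j $ a - x a * (s j \<bullet> s c)"
      using j ja by (simp add: sum_subtractf q \<sigma> flip: sum_distrib_left)
    finally show ?thesis using j by (simp add: q'_def)
  qed
  have upd: "psb_update E (s c) (y c) $$ (a, b) = B0 $$ (a, b)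
      + (\<Sum>i<Suc c. w i $ a * q' i b) + (\<Sum>i<Suc c. w i $ b * q' i a)
      - (\<Sum>i<Suc c. \<Sum>j<Suc c. t (max i j) (min i j) * q' i a * q' j b)"
    if ab: "a < n" "b < n" for a b
  proof -
    have wq: "(\<Sum>i<c. w i $ d * q' i e) = (\<Sum>i<c. w i $ d * q i e) - F d * x e" for d e
      unfolding F_def by (simp add: q'_def algebra_simps sum_subtractf sum_distrib_left)
    have tq: "(\<Sum>i<c. t c i * q' i d) = G d - N * x d" for d
      unfolding G_def N_def by (simp add: q'_def algebra_simps sum_subtractf sum_distrib_left)
    have Tq: "?T (\<lambda>i. q' i a) (\<lambda>j. q' j b) = ?T (\<lambda>i. q i a) (\<lambda>j. q j b)
        - H a * x b - x a * H b + K * x a * x b"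
      unfolding H_def[of a] H_sym[of b, symmetric] K_def
      by (simp add: q'_def algebra_simps sum.distrib sum_subtractf sum_distrib_left)
    \<comment> \<open>Split off the last row and column: for \<open>i < c\<close> the larger index
      is \<open>c\<close>, so both borders have coefficients \<open>t c i\<close>, and the corner is
      \<open>t c c\<close>.\<close>
    have "(\<Sum>i<Suc c. \<Sum>j<Suc c. t (max i j) (min i j) * q' i a * q' j b)
        = ?T (\<lambda>i. q' i a) (\<lambda>j. q' j b) + (\<Sum>i<c. t c i * q' i a) * x b
          + x a * (\<Sum>i<c. t c i * q' i b) + t c c * x a * x b"
      by (simp add: q'_def sum.distrib sum_distrib_left sum_distrib_right mult_ac)
    also have "\<dots> = ?T (\<lambda>i. q i a) (\<lambda>j. q j b)
        - H a * x b - x a * H b + K * x a * x b + (G a - N * x a) * x b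
        + x a * (G b - N * x b) + t c c * x a * x b"
      unfolding Tq tq ..
    finally have T': "(\<Sum>i<Suc c. \<Sum>j<Suc c. t (max i j) (min i j) * q' i a * q' j b) = \<dots>" .
    have "psb_update E (s c) (y c) $$ (a, b) = E $$ (a, b) + (v $ a * x b + x a * v $ b)
        - (v \<bullet> s c) * x a * x b"
      unfolding v_def x_def \<rho>_def using Ec sc yc ab by (intro psb_update_index) auto
    \<comment> \<open>What remains is a polynomial identity. The coefficient of
      \<open>x a * x b\<close> agrees because each border contributes one \<open>N\<close>, matching
      \<open>t c c - 2 * N + K\<close>.\<close>
    then show ?thesis
      unfolding T' vs using ab
      by (simp add: v E wq) (simp add: q'_def algebra_simps)
  qed
  show ?case
    by (rule exI[of _ q']) (use q'_eq upd in \<open>simp add: E_def t_def\<close>)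
qed

section \<open>The inverse of the middle matrix and the block product\<close>

lemma upper_part_invertible:
  fixes A :: "'a :: field mat"
  assumes A: "A \<in> carrier_mat r r" and nz: "\<And>i. i < r \<Longrightarrow> A $$ (i, i) \<noteq> 0"
  obtains V where "V \<in> carrier_mat r r" "upper_part A * V = 1\<^sub>m r" "V * upper_part A = 1\<^sub>m r"
proof -
  have U: "upper_part A \<in> carrier_mat r r" using A by (simp add: upper_part_def)
  have "upper_triangular (upper_part A)" using A by (auto simp: upper_part_def)
  then have "det (upper_part A) = prod_list (diag_mat (upper_part A))"
    using U by (rule det_upper_triangular)
  \<comment> \<open>Only the diagonal of \<open>A\<close> enters. The upper part of a Gram matrix of
    nonzero vectors is thus invertible even if the vectors are linearly dependent and the Gram
    matrix is singular.\<close>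
  also have "\<dots> \<noteq> 0"
    using A nz by (auto simp: prod_list_zero_iff diag_mat_def upper_part_def)
  finally have "upper_part A \<in> Units (ring_mat TYPE('a) r ())"
    by (rule det_non_zero_imp_unit[OF U])
  then show thesis using that by (auto simp: Units_def ring_mat_def)
qed

text \<open>The zero corner allows block elimination in \<open>M * N = 1\<close>: the upper block
  row forces the lower blocks \<open>V\<close> and \<open>0\<close>, and the lower block row then
  gives \<open>V\<^sup>T\<close> and \<open>-V\<^sup>T T V\<close>.\<close>

lemma four_block_zero_inverse:
  fixes U T V :: "'a :: comm_ring_1 mat"
  assumes U: "U \<in> carrier_mat r r" and T: "T \<in> carrier_mat r r" and V: "V \<in> carrier_mat r r"
    and UV: "U * V = 1\<^sub>m r" and VU: "V * U = 1\<^sub>m r"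
  defines "M \<equiv> four_block_mat (0\<^sub>m r r) U U\<^sup>T T"
    and "N \<equiv> four_block_mat (- (V\<^sup>T * T * V)) V\<^sup>T V (0\<^sub>m r r)"
  shows "M * N = 1\<^sub>m (r + r)" and "N * M = 1\<^sub>m (r + r)"
proof -
  have UVt: "U\<^sup>T * V\<^sup>T = 1\<^sub>m r" and VUt: "V\<^sup>T * U\<^sup>T = 1\<^sub>m r"
    using UV VU by (simp_all flip: transpose_mult[OF V U] transpose_mult[OF U V])
  have [simp]: "U\<^sup>T \<in> carrier_mat r r" "V\<^sup>T \<in> carrier_mat r r" using U V by auto
  have TV: "V\<^sup>T * T * V \<in> carrier_mat r r" using T V by auto
  have 1: "U\<^sup>T * - (V\<^sup>T * T * V) + T * V = 0\<^sub>m r r"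
  proof -
    have "U\<^sup>T * (V\<^sup>T * T * V) = (U\<^sup>T * V\<^sup>T) * (T * V)"
      using U T V by (simp add: assoc_mult_mat[of _ r r _ r _ r])
    also have "\<dots> = T * V" using T V by (simp add: UVt)
    finally have "U\<^sup>T * - (V\<^sup>T * T * V) = - (T * V)"
      using U TV by (subst uminus_mult_right_mat) auto
    then show ?thesis using T V by (simp add: uminus_l_inv_mat[of _ r r])
  qed
  have 2: "- (V\<^sup>T * T * V) * U + V\<^sup>T * T = 0\<^sub>m r r"
  proof -
    have "(V\<^sup>T * T * V) * U = V\<^sup>T * T"
      using T V U by (simp add: assoc_mult_mat[of _ r r _ r _ r] VU)
    then have "- (V\<^sup>T * T * V) * U = - (V\<^sup>T * T)"
      using U TV by (subst uminus_mult_left_mat) auto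
    then show ?thesis using T V by (simp add: uminus_l_inv_mat[of _ r r])
  qed
  have one: "four_block_mat (1\<^sub>m r) (0\<^sub>m r r) (0\<^sub>m r r) (1\<^sub>m r) = (1\<^sub>m (r + r) :: 'a mat)"
    by (rule four_block_one_mat)
  have "M * N = four_block_mat (0\<^sub>m r r * - (V\<^sup>T * T * V) + U * V) (0\<^sub>m r r * V\<^sup>T + U * 0\<^sub>m r r)
      (U\<^sup>T * - (V\<^sup>T * T * V) + T * V) (U\<^sup>T * V\<^sup>T + T * 0\<^sub>m r r)"
    unfolding M_def N_def using U V T TV by (intro mult_four_block_mat) auto
  also have "\<dots> = 1\<^sub>m (r + r)"
    unfolding 1 UV UVt using U V T TV by (simp add: one del: uminus_mult_right_mat)
  finally show "M * N = 1\<^sub>m (r + r)" .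
  have "N * M = four_block_mat (- (V\<^sup>T * T * V) * 0\<^sub>m r r + V\<^sup>T * U\<^sup>T) (- (V\<^sup>T * T * V) * U + V\<^sup>T * T)
      (V * 0\<^sub>m r r + 0\<^sub>m r r * U\<^sup>T) (V * U + 0\<^sub>m r r * T)"
    unfolding M_def N_def using U V T TV by (intro mult_four_block_mat) auto
  also have "\<dots> = 1\<^sub>m (r + r)"
    unfolding 2 VU VUt using U V T TV by (simp add: one del: uminus_mult_left_mat)
  finally show "N * M = 1\<^sub>m (r + r)" .
qed

text \<open>This excludes \<open>None\<close>, for which \<open>the (mat_inverse M)\<close> would be
  unspecified, and identifies the computed inverse by uniqueness of two-sided inverses.\<close>

lemma mat_inverse_eqI:
  fixes M N :: "'a :: field mat"
  assumes M: "M \<in> carrier_mat d d" and N: "N \<in> carrier_mat d d"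
    and MN: "M * N = 1\<^sub>m d" and NM: "N * M = 1\<^sub>m d"
  shows "mat_inverse M = Some N"
proof (cases "mat_inverse M")
  case None
  then have "M \<notin> Units (ring_mat TYPE('a) d ())" by (rule mat_inverse(1)[OF M])
  then show ?thesis using assms by (auto simp: Units_def ring_mat_def)
next
  case (Some P)
  then have P: "P * M = 1\<^sub>m d" "P \<in> carrier_mat d d" using mat_inverse(2)[OF M] by auto
  have "P = P * (M * N)" unfolding MN using P by simp
  also have "\<dots> = (P * M) * N" using P(2) M N by (rule assoc_mult_mat[symmetric])
  also have "\<dots> = N" using P(1) N by simp
  finally show ?thesis using Some by simp
qed

text \<open>The first product is the block row \<open>[W V - Q T V, Q]\<close>. Multiplying by the
  transposed block row turns each \<open>V S\<^sup>T\<close> into \<open>Q\<^sup>T\<close>.\<close>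

lemma append_cols_block_product:
  fixes S W T V :: "'a :: comm_ring_1 mat"
  assumes S: "S \<in> carrier_mat n r" and W: "W \<in> carrier_mat n r"
    and T: "T \<in> carrier_mat r r" and V: "V \<in> carrier_mat r r"
  defines "Q \<equiv> S * V\<^sup>T"
  shows "append_cols S W * four_block_mat (- (V\<^sup>T * T * V)) V\<^sup>T V (0\<^sub>m r r) * (append_cols S W)\<^sup>T
    = W * Q\<^sup>T + Q * W\<^sup>T - Q * T * Q\<^sup>T"
proof -
  let ?Z = "0\<^sub>m 0 r :: 'a mat"
  have X: "append_cols S W = four_block_mat S W ?Z ?Z"
    using S W by (simp add: append_cols_def)
  have Vt: "V\<^sup>T \<in> carrier_mat r r" and TV: "V\<^sup>T * T * V \<in> carrier_mat r r"
    and Q: "Q \<in> carrier_mat n r" using S T V by (auto simp: Q_def)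
  have Qt: "Q\<^sup>T = V * S\<^sup>T" unfolding Q_def using transpose_mult[OF S Vt] by simp
  have "append_cols S W * four_block_mat (- (V\<^sup>T * T * V)) V\<^sup>T V (0\<^sub>m r r)
      = four_block_mat (S * - (V\<^sup>T * T * V) + W * V) (S * V\<^sup>T + W * 0\<^sub>m r r)
        (?Z * - (V\<^sup>T * T * V) + ?Z * V) (?Z * V\<^sup>T + ?Z * 0\<^sub>m r r)"
    unfolding X using S W V T TV by (intro mult_four_block_mat) auto
  also have "\<dots> = four_block_mat (W * V - Q * T * V) Q ?Z ?Z"
  proof -
    have "S * (V\<^sup>T * T * V) = Q * T * V"
      unfolding Q_def using S T V Vt
      by (simp add: assoc_mult_mat[of _ n r _ r _ r] assoc_mult_mat[of _ r r _ r _ r])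
    then have "S * - (V\<^sup>T * T * V) + W * V = W * V - Q * T * V"
      using S W T V TV Q by (auto intro!: eq_matI)
    moreover have "?Z * A + ?Z * B = ?Z" if "A \<in> carrier_mat r r" "B \<in> carrier_mat r r" for A B
      using that by (intro eq_matI) auto
    ultimately show ?thesis using S W T V Vt TV Q by (simp add: Q_def[symmetric] del: uminus_mult_right_mat)
  qed
  finally have XN: "append_cols S W * four_block_mat (- (V\<^sup>T * T * V)) V\<^sup>T V (0\<^sub>m r r) = \<dots>" .
  have Xt: "(append_cols S W)\<^sup>T = four_block_mat S\<^sup>T (0\<^sub>m r 0) W\<^sup>T (0\<^sub>m r 0)"
    unfolding X using S W by (subst transpose_four_block_mat) auto
  have "append_cols S W * four_block_mat (- (V\<^sup>T * T * V)) V\<^sup>T V (0\<^sub>m r r) * (append_cols S W)\<^sup>T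
      = four_block_mat ((W * V - Q * T * V) * S\<^sup>T + Q * W\<^sup>T)
        ((W * V - Q * T * V) * 0\<^sub>m r 0 + Q * 0\<^sub>m r 0)
        (?Z * S\<^sup>T + ?Z * W\<^sup>T) (?Z * 0\<^sub>m r 0 + ?Z * 0\<^sub>m r 0)"
    unfolding XN Xt using S W V T Q by (intro mult_four_block_mat) auto
  \<comment> \<open>The other three blocks have no rows or no columns, so the block matrix is its
    upper left block.\<close>
  also have "\<dots> = (W * V - Q * T * V) * S\<^sup>T + Q * W\<^sup>T"
    using S W V T Q by (intro eq_matI) auto
  also have "(W * V - Q * T * V) * S\<^sup>T = W * V * S\<^sup>T - Q * T * V * S\<^sup>T"
    using S W V T Q by (intro minus_mult_distrib_mat[of _ n r _ _ n]) auto
  also have "\<dots> = W * Q\<^sup>T - Q * T * Q\<^sup>T"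
    unfolding Qt using S W V T Q
    by (simp add: assoc_mult_mat[of _ n r _ r _ n])
  also have "\<dots> + Q * W\<^sup>T = W * Q\<^sup>T + Q * W\<^sup>T - Q * T * Q\<^sup>T"
    using S W V T Q by (intro eq_matI) auto
  finally show ?thesis .
qed

section \<open>The compact representation\<close>

theorem theorem4p3:
  fixes n k m r :: nat
    and B0 S Y W U L D M :: "real mat"
    and s y :: "nat \<Rightarrow> real vec"
  assumes "k \<ge> 1" and "m \<ge> 1"
    and r: "r = min m k"
    and "B0 \<in> carrier_mat n n"
    and "\<And>i. i \<in> {k - r..<k} \<Longrightarrow> s i \<in> carrier_vec n"
    and "\<And>i. i \<in> {k - r..<k} \<Longrightarrow> y i \<in> carrier_vec n"
    and "\<And>i. i \<in> {k - r..<k} \<Longrightarrow> s i \<noteq> 0\<^sub>v n"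
    and S: "S = mat_of_cols n (map s [k - r..<k])"
    and Y: "Y = mat_of_cols n (map y [k - r..<k])"
    and W: "W = Y - B0 * S"
    and U: "U = upper_part (transpose_mat S * S)"
    and L: "L = strict_lower_part (transpose_mat S * W)"
    and D: "D = diag_part (transpose_mat S * W)"
    and M: "M = four_block_mat (0\<^sub>m r r) U (transpose_mat U) (L + D + transpose_mat L)"
  shows "invertible_mat M \<and>
    lm_psb m k s y B0 =
      B0 + append_cols S W * the (mat_inverse M) * transpose_mat (append_cols S W)"
proof -
  note B0 = assms(4)
  have rk: "r \<le> k" using r by simp
  \<comment> \<open>Renumber the used pairs from 0, so that pair indices coincide with column
    indices of \<open>S\<close> and \<open>W\<close>.\<close>
  define s' where "s' i = s (k - r + i)" for i
  define y' where "y' i = y (k - r + i)" for i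
  define w' where "w' i = y' i - B0 *\<^sub>v s' i" for i
  have s'c: "s' i \<in> carrier_vec n" and y'c: "y' i \<in> carrier_vec n" and s'nz: "s' i \<noteq> 0\<^sub>v n"
    if "i < r" for i
    using assms(5-7)[of "k - r + i"] that rk unfolding s'_def y'_def by force+
  have w'c: "w' i \<in> carrier_vec n" if "i < r" for i
    using s'c[OF that] y'c[OF that] B0 by (simp add: w'_def)
  have shift: "[k - r..<k] = map (\<lambda>i. k - r + i) [0..<r]"
    using rk by (intro nth_equalityI) auto
  have lm: "lm_psb m k s y B0 = fold (\<lambda>i B. psb_update B (s' i) (y' i)) [0..<r] B0"
    by (simp add: lm_psb_def shift fold_map comp_def s'_def y'_def flip: r)
  have Sc: "S \<in> carrier_mat n r" and Yc: "Y \<in> carrier_mat n r"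
    using rk by (auto simp: S Y)
  have Wc: "W \<in> carrier_mat n r" unfolding W using Sc Yc B0 by auto
  have colS: "col S i = s' i" if "i < r" for i
    using that rk s'c[OF that] by (simp add: S s'_def)
  have colY: "col Y i = y' i" if "i < r" for i
    using that rk y'c[OF that] by (simp add: Y y'_def)
  have colW: "col W i = w' i" if "i < r" for i
  proof -
    have "col W i = col Y i - col (B0 * S) i"
      unfolding W using that Sc Yc B0 by (intro eq_vecI) auto
    then show ?thesis using that Sc B0 by (simp add: w'_def colY colS col_mult2[of B0 n n S r] mult_mat_vec_def)
  qed
  have Sidx: "S $$ (a, i) = s' i $ a" and Widx: "W $$ (a, i) = w' i $ a" if "a < n" "i < r" for a i
    using that Sc Wc colS[of i] colW[of i] by (metis carrier_matD index_col)+
  define T where "T = L + D + L\<^sup>T"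
  have SW: "(S\<^sup>T * W) $$ (i, j) = s' i \<bullet> w' j" if "i < r" "j < r" for i j
    using that Sc Wc by (simp add: colS colW)
  have SS: "(S\<^sup>T * S) $$ (i, j) = s' i \<bullet> s' j" if "i < r" "j < r" for i j
    using that Sc by (simp add: colS)
  have SSc: "S\<^sup>T * S \<in> carrier_mat r r" using Sc by auto
  have Uc: "U \<in> carrier_mat r r" using Sc by (auto simp: U upper_part_def)
  have Tc: "T \<in> carrier_mat r r"
    using Sc Wc by (auto simp: T_def L D strict_lower_part_def diag_part_def)
  have Uidx: "U $$ (i, j) = (if i \<le> j then s' i \<bullet> s' j else 0)" if "i < r" "j < r" for i j
    using that Sc SS[OF that] by (simp add: U upper_part_def)
  have Tidx: "T $$ (i, j) = s' (max i j) \<bullet> w' (min i j)" if "i < r" "j < r" for i j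
    using that Sc Wc SW[OF that] SW[OF that(2,1)]
    by (auto simp: T_def L D strict_lower_part_def diag_part_def max_def min_def)
  obtain V where V: "V \<in> carrier_mat r r" "U * V = 1\<^sub>m r" "V * U = 1\<^sub>m r"
  proof (rule upper_part_invertible[OF SSc])
    fix i assume i: "i < r"
    then show "(S\<^sup>T * S) $$ (i, i) \<noteq> 0"
      using SS[OF i i] s'c[OF i] s'nz[OF i] conjugate_square_eq_0_vec[of "s' i" n] by simp
  qed (use that U in auto)
  define N where "N = four_block_mat (- (V\<^sup>T * T * V)) V\<^sup>T V (0\<^sub>m r r)"
  have Mc: "M \<in> carrier_mat (r + r) (r + r)" using Uc Tc by (simp add: M T_def)
  have Nc: "N \<in> carrier_mat (r + r) (r + r)" using V Tc by (simp add: N_def)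
  have MN: "M * N = 1\<^sub>m (r + r)" "N * M = 1\<^sub>m (r + r)"
    unfolding M N_def T_def[symmetric] using four_block_zero_inverse[OF Uc Tc V] by auto
  have inv: "invertible_mat M"
    unfolding invertible_mat_def inverts_mat_def using MN Mc Nc by (auto intro!: exI[of _ N])
  have the_inv: "the (mat_inverse M) = N"
    using mat_inverse_eqI[OF Mc Nc MN] by simp
  obtain q :: "nat \<Rightarrow> nat \<Rightarrow> real" where
    q: "\<And>j a. j < r \<Longrightarrow> a < n \<Longrightarrow> (\<Sum>i=j..<r. q i a * (s' j \<bullet> s' i)) = s' j $ a" and
    Bk: "\<And>a b. a < n \<Longrightarrow> b < n \<Longrightarrow> lm_psb m k s y B0 $$ (a, b) =
      B0 $$ (a, b) + (\<Sum>i<r. w' i $ a * q i b) + (\<Sum>i<r. w' i $ b * q i a)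
        - (\<Sum>i<r. \<Sum>j<r. (s' (max i j) \<bullet> w' (min i j)) * q i a * q j b)"
    using fold_psb_update_entries[where s = s' and y = y' and c = r, OF B0 s'c y'c s'nz] unfolding lm w'_def by blast
  define Q where "Q = mat n r (\<lambda>(a, i). q i a)"
  have Qc: "Q \<in> carrier_mat n r" by (simp add: Q_def)
  have QU: "Q * U\<^sup>T = S"
  proof (rule eq_matI)
    fix a j assume "a < dim_row S" "j < dim_col S"
    then have aj: "a < n" "j < r" using Sc by auto
    \<comment> \<open>Row \<open>j\<close> of \<open>U\<close> vanishes to the left of the diagonal,
      which cuts the sum down to the tail in \<open>q\<close>.\<close>
    have "(Q * U\<^sup>T) $$ (a, j) = (\<Sum>i=0..<r. q i a * U $$ (j, i))"
      using aj Uc by (simp add: Q_def scalar_prod_def)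
    also have "\<dots> = (\<Sum>i=j..<r. q i a * (s' j \<bullet> s' i))"
      using aj by (intro sum.mono_neutral_cong_right) (auto simp: Uidx)
    finally show "(Q * U\<^sup>T) $$ (a, j) = S $$ (a, j)" using aj by (simp add: q Sidx)
  qed (use Uc Sc in \<open>auto simp: Q_def\<close>)
  \<comment> \<open>Cancelling \<open>U\<^sup>T\<close> identifies the recursively built
    \<open>Q\<close> with the matrix \<open>S V\<^sup>T\<close> of the block product.\<close>
  have "S * V\<^sup>T = Q * (U\<^sup>T * V\<^sup>T)"
    unfolding QU[symmetric] using Qc Uc V by (intro assoc_mult_mat) auto
  also have "U\<^sup>T * V\<^sup>T = 1\<^sub>m r" using transpose_mult[OF V(1) Uc] V by simp
  finally have SV: "S * V\<^sup>T = Q" using Qc by simp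
  have "lm_psb m k s y B0 = B0 + (W * Q\<^sup>T + Q * W\<^sup>T - Q * T * Q\<^sup>T)"
  proof (rule eq_matI)
    fix a b assume "a < dim_row (B0 + (W * Q\<^sup>T + Q * W\<^sup>T - Q * T * Q\<^sup>T))"
      "b < dim_col (B0 + (W * Q\<^sup>T + Q * W\<^sup>T - Q * T * Q\<^sup>T))"
    then have ab: "a < n" "b < n" using Qc by auto
    have "(W * Q\<^sup>T) $$ (a, b) = (\<Sum>i<r. w' i $ a * q i b)"
      using ab Wc by (simp add: Q_def scalar_prod_def lessThan_atLeast0 Widx)
    moreover have "(Q * W\<^sup>T) $$ (a, b) = (\<Sum>i<r. w' i $ b * q i a)"
      using ab Wc by (simp add: Q_def scalar_prod_def lessThan_atLeast0 Widx mult.commute)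
    moreover have "(Q * T * Q\<^sup>T) $$ (a, b) =
        (\<Sum>i<r. \<Sum>j<r. (s' (max i j) \<bullet> w' (min i j)) * q i a * q j b)"
    proof -
      have "(Q * T * Q\<^sup>T) $$ (a, b) = (\<Sum>j<r. (\<Sum>i<r. q i a * T $$ (i, j)) * q j b)"
        using ab Tc by (simp add: Q_def scalar_prod_def lessThan_atLeast0)
      also have "\<dots> = (\<Sum>i<r. \<Sum>j<r. T $$ (i, j) * q i a * q j b)"
        unfolding sum_distrib_right by (subst sum.swap) (simp add: mult_ac)
      finally show ?thesis by (simp add: Tidx)
    qed
    ultimately show "lm_psb m k s y B0 $$ (a, b) =
        (B0 + (W * Q\<^sup>T + Q * W\<^sup>T - Q * T * Q\<^sup>T)) $$ (a, b)"
      using ab B0 Wc Qc Tc by (simp add: Bk)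
  qed (use fold_psb_update_carrier[where s = s' and y = y' and c = r, OF B0 s'c y'c] Qc in \<open>auto simp: lm\<close>)
  then show ?thesis
    using inv append_cols_block_product[OF Sc Wc Tc V(1)] by (simp add: the_inv N_def SV)
qed

end
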